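(* Let $0<\phi<1$, $0<\alpha_-<1$, $0<\delta_-\le1$. Suppose $\phi(1-\phi^{m-1})/(1-\phi)\le s<\phi(1-\phi^m)/(1-\phi)$ for some positive integer $m$. Then any feasible solution $\mathbf{z}\in\mathcal{Z}_-(s)$ is a convex combination of the vectors $\mathbf{z}^{j,k}\in\mathcal{Z}_-^j(s)$, $0\le j\le m-1$, $k\ge m$. Therefore, the optimal solution to the loss-part problem (LP) belongs to $\bigcup_{j=0}^{m-1}\mathcal{Z}_-^j(s)$, i.e., $\mathbf{z}^*\in\bigcup_{j=0}^{m-1}\mathcal{Z}_-^j(s)$.
   Context: $\mathcal{Z}_-(s)$ is the set of sequences $\mathbf{z}=(z_1,z_2,\dots)$ with $1\ge z_1\ge z_2\ge\dots\ge0$, $\sum_{n=1}^\infty z_n<\infty$ and $\sum_{n=1}^\infty\phi^n z_n=s$. The loss-part problem (LP) is to minimize $v_-(\mathbf{z};s)=\sum_{n=1}^\infty\big((n+1)^{\alpha_-}-n^{\alpha_-}\big)z_n^{\delta_-}$ over $\mathbf{z}\in\mathcal{Z}_-(s)$; $\mathbf{z}^*$ denotes its optimal solution. For integers $0\le j\le m-1$ and $k\ge m$, $\mathbf{z}^{j,k}\in\mathcal{Z}_-(s)$ is the sequence $$z^{j,k}_1=\dots=z^{j,k}_j=1,\quad z^{j,k}_{j+1}=\dots=z^{j,k}_k=\frac{s(1-\phi)-\phi(1-\phi^j)}{\phi^{j+1}(1-\phi^{k-j})},\quad z^{j,k}_{k+1}=z^{j,k}_{k+2}=\dots=0,$$ and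 $\mathcal{Z}_-^j(s)=\{\mathbf{z}^{j,k}:k\ge m\}$. Convex combinations may involve countably many vectors: coordinatewise convergent sums $\sum_i t_i\mathbf{z}^{(i)}$ with $t_i\ge0$ and $\sum_i t_i=1$. *)

theory Defs
  imports "HOL-Analysis.Analysis"
begin

text \<open>
  Sequences are indexed from 0: the entry \<open>z n\<close> stands for the mathematical $z_{n+1}$, so a
  sequence of type \<^typ>\<open>nat \<Rightarrow> real\<close> has no unused entry.
\<close>

definition Zminus :: "real \<Rightarrow> real \<Rightarrow> (nat \<Rightarrow> real) set" where
  "Zminus \<phi> s = {z. z 0 \<le> 1 \<and> decseq z \<and> (\<forall>n. 0 \<le> z n) \<and> summable z \<and>
                    (\<lambda>n. \<phi> ^ Suc n * z n) sums s}"

text \<open>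
  The objective is \<^typ>\<open>ennreal\<close>-valued because the series may diverge to infinity
  on \<^const>\<open>Zminus\<close>: summability of \<open>z\<close> does not bound the series when \<open>\<delta> < 1\<close>.
\<close>

definition vminus :: "real \<Rightarrow> real \<Rightarrow> (nat \<Rightarrow> real) \<Rightarrow> ennreal" where
  "vminus \<alpha> \<delta> z =
     (\<Sum>n. ennreal ((real (n + 2) powr \<alpha> - real (n + 1) powr \<alpha>) * z n powr \<delta>))"

definition LP_optimal :: "real \<Rightarrow> real \<Rightarrow> real \<Rightarrow> real \<Rightarrow> (nat \<Rightarrow> real) \<Rightarrow> bool" where
  "LP_optimal \<phi> \<alpha> \<delta> s z \<longleftrightarrow> is_arg_min (vminus \<alpha> \<delta>) (\<lambda>y. y \<in> Zminus \<phi> s) z"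

definition zjk :: "real \<Rightarrow> real \<Rightarrow> nat \<Rightarrow> nat \<Rightarrow> nat \<Rightarrow> real" where
  "zjk \<phi> s j k n =
     (if n < j then 1
      else if n < k then (s * (1 - \<phi>) - \<phi> * (1 - \<phi> ^ j)) / (\<phi> ^ (j + 1) * (1 - \<phi> ^ (k - j)))
      else 0)"

definition Zj :: "real \<Rightarrow> real \<Rightarrow> nat \<Rightarrow> nat \<Rightarrow> (nat \<Rightarrow> real) set" where
  "Zj \<phi> s m j = {zjk \<phi> s j k | k. m \<le> k}"

text \<open>
  Finite combinations are included, since weights may be 0 and the points \<open>x i\<close> may repeat.
\<close>

definition countable_convex_combination :: "(nat \<Rightarrow> real) set \<Rightarrow> (nat \<Rightarrow> real) \<Rightarrow> bool" where
  "countable_convex_combination S z \<longleftrightarrow>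
     (\<exists>(t :: nat \<Rightarrow> real) (x :: nat \<Rightarrow> nat \<Rightarrow> real).
        (\<forall>i. 0 \<le> t i) \<and> t sums 1 \<and> (\<forall>i. x i \<in> S) \<and> (\<forall>n. (\<lambda>i. t i * x i n) sums z n))"

end

theory Submission
  imports Defs "HOL-Real_Asymp.Real_Asymp"
begin

text \<open>
  The jumps \<open>p k\<close> of a feasible sequence are the weights of a probability distribution on the step
  sequences $(1,\dots,1,0,\dots)$ with \<open>k\<close> ones, and the moment constraint says that
  $S_k = \phi + \dots + \phi^k$ has mean \<open>s\<close> under it. As in Skorokhod's embedding, such a distribution
  is a mixture of two-point distributions on \<open>j < m \<le> k\<close> with the same mean, which are exactly the
  $z^{j,k}$: the pair \<open>(j, k)\<close> gets weight $p_j p_k (S_k - S_j) / D$, where $D$ is the common value of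
  $\sum_{j<m} p_j (s - S_j)$ and $\sum_{k\ge m} p_k (S_k - s)$.

  By Jensen's inequality the concave objective is at least its infimum over the $z^{j,k}$, strictly
  so at any other sequence of finite value if \<open>\<delta> < 1\<close>. This infimum is attained because for fixed
  \<open>j\<close> either the value tends to infinity with \<open>k\<close>, or $s = S_j$ and $z^{j,k}$ does not depend on \<open>k\<close>.
\<close>

section \<open>Interleaved series and Jensen's inequality for powers\<close>

text \<open>One natural number \<open>r\<close> encodes the pair \<open>(r mod m, r div m)\<close>.
  Each series is padded with zeros outside its residue class, so the interleaved series is a finite
  sum of convergent ones.\<close>

lemma sums_interleave:
  fixes f :: "nat \<Rightarrow> nat \<Rightarrow> 'a::real_normed_vector"
  assumes "0 < m" and "\<And>j. j < m \<Longrightarrow> f j sums c j"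
  shows "(\<lambda>r. f (r mod m) (r div m)) sums (\<Sum>j<m. c j)"
proof -
  have "(\<lambda>r. if r mod m = j then f j (r div m) else 0) sums c j" if "j < m" for j
  proof -
    let ?g = "\<lambda>i. i * m + j"
    have "strict_mono ?g"
      using \<open>0 < m\<close> by (simp add: strict_mono_def)
    moreover have "r mod m \<noteq> j" if "r \<notin> range ?g" for r
      using that div_mult_mod_eq[of r m] by (metis rangeI)
    ultimately show ?thesis
      using sums_mono_reindex[of ?g "\<lambda>r. if r mod m = j then f j (r div m) else 0" "c j"]
        assms(2)[OF that] that by simp
  qed
  then have "(\<lambda>r. \<Sum>j<m. if r mod m = j then f j (r div m) else 0) sums (\<Sum>j<m. c j)"
    by (intro sums_sum) auto
  moreover have "(\<Sum>j<m. if r mod m = j then f j (r div m) else 0) = f (r mod m) (r div m)" for r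
    using \<open>0 < m\<close> by (simp add: sum.delta')
  ultimately show ?thesis
    by simp
qed

text \<open>Dividing by \<open>a\<close> reduces the claim to the strict weighted AM-GM inequality for \<open>u = x / a\<close> and 1.\<close>

lemma powr_less_tangent:
  fixes a x \<delta> :: real
  assumes "0 < \<delta>" "\<delta> < 1" "0 < a" "0 \<le> x" "x \<noteq> a"
  shows "x powr \<delta> < a powr \<delta> + \<delta> * (a powr \<delta> / a) * (x - a)"
proof -
  define u where "u = x / a"
  define w where "w = \<delta> * u + (1 - \<delta>)"
  have u: "0 \<le> u" "u \<noteq> 1"
    using assms by (auto simp: u_def)
  have w: "0 < w"
    using assms u by (simp add: w_def add_nonneg_pos)
  have "u powr \<delta> < w"
  proof (cases "u = 0")
    case False
    then have "0 < u"
      using u by simp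
    have "w \<noteq> 1"
      using u assms(1) by (simp add: w_def algebra_simps)
    \<comment> \<open>The points \<open>u / w\<close> and \<open>1 / w\<close> have mean 1 for the
      weights \<open>\<delta>\<close> and \<open>1 - \<delta>\<close>, by the choice of
      \<open>w\<close>; hence the bounds by \<open>y - 1\<close> average to 0. Strictness comes from
      \<open>1 / w\<close>, which differs from 1.\<close>
    have "ln (u / w) \<le> u / w - 1"
      using \<open>0 < u\<close> w by (intro ln_le_minus_one) simp
    moreover have "ln (1 / w) < 1 / w - 1"
      using ln_le_minus_one[of "1 / w"] ln_eq_minus_one[of "1 / w"] w \<open>w \<noteq> 1\<close>
      by (force simp: less_le)
    ultimately have "\<delta> * ln (u / w) + (1 - \<delta>) * ln (1 / w)
        < \<delta> * (u / w - 1) + (1 - \<delta>) * (1 / w - 1)"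
      using assms by (intro add_le_less_mono mult_left_mono mult_strict_left_mono) auto
    also have "\<dots> = (\<delta> * u + (1 - \<delta>)) / w - 1"
      by (simp add: algebra_simps add_divide_distrib diff_divide_distrib)
    also have "\<dots> = 0"
      using w by (simp add: w_def)
    finally have "\<delta> * ln u < ln w"
      using \<open>0 < u\<close> w by (simp add: ln_div algebra_simps)
    then show ?thesis
      using \<open>0 < u\<close> w by (metis exp_less_cancel_iff exp_ln powr_def less_irrefl)
  qed (use w in simp)
  then have "a powr \<delta> * u powr \<delta> < a powr \<delta> * w"
    using assms by simp
  moreover have "a powr \<delta> * u powr \<delta> = x powr \<delta>"
    using assms u by (simp add: u_def powr_divide)
  moreover have "a powr \<delta> * w = a powr \<delta> + \<delta> * (a powr \<delta> / a) * (x - a)"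
    using assms by (simp add: w_def u_def field_simps)
  ultimately show ?thesis
    by simp
qed

lemma powr_le_tangent:
  fixes a x \<delta> :: real
  assumes "0 < \<delta>" "\<delta> \<le> 1" "0 < a" "0 \<le> x"
  shows "x powr \<delta> \<le> a powr \<delta> + \<delta> * (a powr \<delta> / a) * (x - a)"
proof (cases "x = a \<or> \<delta> = 1")
  case False
  then show ?thesis
    using powr_less_tangent[of \<delta> a x] assms by simp
qed (use assms in auto)

text \<open>The tangent bound at the mean \<open>a\<close> is summed with the weights; its linear
  part vanishes because the deviations \<open>x i - a\<close> have mean 0. One index of positive
  weight away from \<open>a\<close> makes the sum strictly smaller.\<close>

lemma jensen_powr_suminf:
  fixes a \<delta> :: real and t x :: "nat \<Rightarrow> real"
  assumes \<delta>: "0 < \<delta>" "\<delta> \<le> 1"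
    and t: "\<And>i. 0 \<le> t i" "t sums 1"
    and x: "\<And>i. 0 \<le> x i" "\<And>i. x i \<le> 1"
    and a: "(\<lambda>i. t i * x i) sums a"
  shows "summable (\<lambda>i. t i * x i powr \<delta>)"
    and "(\<Sum>i. t i * x i powr \<delta>) \<le> a powr \<delta>"
    and "\<delta> < 1 \<Longrightarrow> 0 < t i \<Longrightarrow> x i \<noteq> a \<Longrightarrow> (\<Sum>i. t i * x i powr \<delta>) < a powr \<delta>"
proof -
  have tx: "0 \<le> t i * x i" for i
    using t x by simp
  have "a \<ge> 0"
    using a tx sums_le[of "\<lambda>_. 0" _ 0 a] by (metis sums_zero)
  have "x i powr \<delta> \<le> 1" for i
    using x \<delta> powr_mono2[of \<delta> "x i" 1] by simp
  then have "norm (t i * x i powr \<delta>) \<le> t i" for i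
    using t by (simp add: mult_left_le)
  then show sm: "summable (\<lambda>i. t i * x i powr \<delta>)"
    using t(2) by (meson summable_comparison_test' sums_summable)
  \<comment> \<open>There is no tangent to use at mean 0, but there every product
    \<open>t i * x i\<close> vanishes. The slope \<open>L\<close> is then 0, since division by 0
    gives 0, so both sides of the later bound are 0.\<close>
  have zero: "t i = 0 \<or> x i = 0" if "a = 0" for i
    using that a tx suminf_eq_zero_iff[of "\<lambda>i. t i * x i"] sums_unique
    by (metis mult_eq_0_iff sums_summable)
  define L where "L = \<delta> * (a powr \<delta> / a)"
  define T where "T = (\<lambda>i. t i * (a powr \<delta> + L * (x i - a)))"
  have "(\<lambda>i. t i * (a powr \<delta>) + L * (t i * x i - t i * a)) sums
      (1 * (a powr \<delta>) + L * (a - 1 * a))"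
    by (intro sums_add sums_mult sums_mult2 sums_diff t a)
  then have T: "T sums (a powr \<delta>)"
    by (simp add: T_def algebra_simps)
  have le: "t i * x i powr \<delta> \<le> T i" for i
  proof (cases "a = 0")
    case True
    then show ?thesis
      using zero[of i] by (auto simp: T_def)
  next
    case False
    then show ?thesis
      unfolding T_def L_def using powr_le_tangent[OF \<delta>, of a "x i"] \<open>a \<ge> 0\<close> x t
      by (intro mult_left_mono) auto
  qed
  then show "(\<Sum>i. t i * x i powr \<delta>) \<le> a powr \<delta>"
    using suminf_le[OF le sm sums_summable[OF T]] sums_unique[OF T] by simp
  assume *: "\<delta> < 1" "0 < t i" "x i \<noteq> a"
  then have "a > 0"
    using zero[of i] \<open>a \<ge> 0\<close> by (cases "a = 0") auto
  then have "t i * x i powr \<delta> < T i"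
    unfolding T_def L_def using powr_less_tangent[of \<delta> a "x i"] * \<delta> x by simp
  then have "0 < (\<Sum>i. T i - t i * x i powr \<delta>)"
    using le sm T by (intro suminf_pos2[where i = i] summable_diff) (auto simp: sums_iff)
  then show "(\<Sum>i. t i * x i powr \<delta>) < a powr \<delta>"
    using T sm by (simp add: sums_iff flip: suminf_diff)
qed

section \<open>The objective under countable mixtures\<close>

lemma vminus_weight_pos:
  assumes "0 < \<alpha>"
  shows "0 < real (n + 2) powr \<alpha> - real (n + 1) powr \<alpha>"
  using powr_less_mono2[of \<alpha> "real (n + 1)" "real (n + 2)"] assms by simp

lemma Zminus_bounds:
  assumes "z \<in> Zminus \<phi> s"
  shows "0 \<le> z n" and "z n \<le> 1"
  using assms decseqD[of z 0 n] by (auto simp: Zminus_def intro: order_trans)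

text \<open>Tonelli's theorem for counting measure on the naturals.\<close>

lemma suminf_ennreal_swap:
  fixes f :: "nat \<Rightarrow> nat \<Rightarrow> ennreal"
  shows "(\<Sum>n. \<Sum>i. f i n) = (\<Sum>i. \<Sum>n. f i n)"
proof -
  have "(\<Sum>n. \<Sum>i. f i n) = (\<integral>\<^sup>+ n. (\<Sum>i. f i n) \<partial>count_space UNIV)"
    by (rule nn_integral_count_space_nat[symmetric])
  also have "\<dots> = (\<Sum>i. \<integral>\<^sup>+ n. f i n \<partial>count_space UNIV)"
    by (rule nn_integral_suminf) simp
  finally show ?thesis
    by (simp add: nn_integral_count_space_nat)
qed

text \<open>Jensen in each coordinate, followed by an exchange of the two sums, bounds the mean of
  the values \<open>vminus \<alpha> \<delta> (x i)\<close> by the value at \<open>z\<close>; that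
  mean is at least \<open>M\<close>.\<close>

lemma vminus_mixture_ge:
  fixes \<alpha> \<delta> :: real and M :: ennreal
  assumes "0 < \<alpha>" "0 < \<delta>" "\<delta> \<le> 1"
    and t: "\<And>i. 0 \<le> t i" "t sums 1"
    and x: "\<And>i n. 0 \<le> x i n" "\<And>i n. x i n \<le> 1"
    and z: "\<And>n. (\<lambda>i. t i * x i n) sums z n"
    and M: "\<And>i. M \<le> vminus \<alpha> \<delta> (x i)"
  shows "M \<le> vminus \<alpha> \<delta> z"
    and "\<delta> < 1 \<Longrightarrow> 0 < t i \<Longrightarrow> x i \<noteq> z \<Longrightarrow> vminus \<alpha> \<delta> z < top \<Longrightarrow> M < vminus \<alpha> \<delta> z"
proof -
  define c where "c = (\<lambda>n. real (n + 2) powr \<alpha> - real (n + 1) powr \<alpha>)"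
  have c: "0 < c n" for n
    using vminus_weight_pos[OF \<open>0 < \<alpha>\<close>] by (simp add: c_def)
  have v: "vminus \<alpha> \<delta> y = (\<Sum>n. ennreal (c n * y n powr \<delta>))" for y
    by (simp add: vminus_def c_def)
  define g where "g = (\<lambda>n. \<Sum>i. t i * x i n powr \<delta>)"
  note jensen = jensen_powr_suminf[OF assms(2,3) t x z]
  have g: "0 \<le> g n" "g n \<le> z n powr \<delta>" for n
    using jensen(1,2)[of n] t(1) by (auto simp: g_def intro!: suminf_nonneg)
  have "M = (\<Sum>i. ennreal (t i) * M)"
    using suminf_ennreal2[OF t(1) sums_summable[OF t(2)]] t(2) by (simp add: sums_iff)
  also have "\<dots> \<le> (\<Sum>i. ennreal (t i) * vminus \<alpha> \<delta> (x i))"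
    by (intro suminf_le mult_left_mono M) auto
  also have "\<dots> = (\<Sum>i. \<Sum>n. ennreal (c n * (t i * x i n powr \<delta>)))"
    using t(1) c[THEN less_imp_le]
    by (simp add: v ennreal_mult[symmetric] mult.left_commute flip: ennreal_suminf_cmult)
  also have "\<dots> = (\<Sum>n. \<Sum>i. ennreal (c n * (t i * x i n powr \<delta>)))"
    by (rule suminf_ennreal_swap[symmetric])
  also have "\<dots> = (\<Sum>n. ennreal (c n * g n))"
    unfolding g_def using t(1) c[THEN less_imp_le] jensen(1)
    by (subst suminf_ennreal2) (auto simp: suminf_mult intro: summable_mult)
  finally have Mg: "M \<le> (\<Sum>n. ennreal (c n * g n))" .
  have le: "c n * g n \<le> c n * z n powr \<delta>" for n
    using g[of n] c[of n] by simp
  have "(\<Sum>n. ennreal (c n * g n)) \<le> vminus \<alpha> \<delta> z"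
    unfolding v using le by (intro suminf_le) (auto intro: ennreal_leI)
  then show "M \<le> vminus \<alpha> \<delta> z"
    using Mg by simp
  assume *: "\<delta> < 1" "0 < t i" "x i \<noteq> z" "vminus \<alpha> \<delta> z < top"
  then obtain N where "x i N \<noteq> z N"
    by auto
  then have "g N < z N powr \<delta>"
    using jensen(3) * by (auto simp: g_def)
  then have less: "c N * g N < c N * z N powr \<delta>"
    using c by simp
  have sm: "summable (\<lambda>n. c n * z n powr \<delta>)"
    using * c[THEN less_imp_le] by (intro summable_suminf_not_top) (auto simp: v)
  have smg: "summable (\<lambda>n. c n * g n)"
    using le g c[THEN less_imp_le] by (intro summable_comparison_test'[OF sm]) auto
  \<comment> \<open>The finite value of \<open>z\<close> makes both series real, so they can be
    subtracted and the strict gap at \<open>N\<close> survives summation.\<close>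
  have "0 < (\<Sum>n. c n * z n powr \<delta> - c n * g n)"
    using less le sm smg by (intro suminf_pos2[where i = N] summable_diff) auto
  then have "(\<Sum>n. c n * g n) < (\<Sum>n. c n * z n powr \<delta>)"
    using sm smg by (simp flip: suminf_diff)
  moreover have "0 \<le> (\<Sum>n. c n * g n)"
    using g c[THEN less_imp_le] smg by (intro suminf_nonneg) auto
  ultimately have "(\<Sum>n. ennreal (c n * g n)) < vminus \<alpha> \<delta> z"
    using sm smg g c[THEN less_imp_le] by (simp add: v suminf_ennreal2 ennreal_less_iff)
  then show "M < vminus \<alpha> \<delta> z"
    using Mg by simp
qed

text \<open>Every competitor is a mixture of points of \<open>S\<close>, so its value is at least
  the minimum over \<open>S\<close>. A point outside \<open>S\<close> differs from all components of
  its mixture, in particular from one of positive weight, and for \<open>\<delta> < 1\<close> the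
  bound becomes strict.\<close>

lemma LP_optimal_of_convex_generators:
  assumes par: "0 < \<alpha>" "0 < \<delta>" "\<delta> \<le> 1"
    and sub: "S \<subseteq> Zminus \<phi> s"
    and gen: "\<And>z. z \<in> Zminus \<phi> s \<Longrightarrow> countable_convex_combination S z"
    and y: "y \<in> S" "vminus \<alpha> \<delta> y < top" "\<And>x. x \<in> S \<Longrightarrow> vminus \<alpha> \<delta> y \<le> vminus \<alpha> \<delta> x"
  shows "LP_optimal \<phi> \<alpha> \<delta> s y"
    and "\<delta> < 1 \<Longrightarrow> LP_optimal \<phi> \<alpha> \<delta> s z \<Longrightarrow> z \<in> S"
proof -
  have bounds: "0 \<le> x n" "x n \<le> 1" if "x \<in> S" for x n
    using Zminus_bounds that sub by blast+
  show "LP_optimal \<phi> \<alpha> \<delta> s y"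
    unfolding LP_optimal_def is_arg_min_def
  proof (intro conjI notI)
    show "y \<in> Zminus \<phi> s"
      using y sub by blast
    assume "\<exists>z. z \<in> Zminus \<phi> s \<and> vminus \<alpha> \<delta> z < vminus \<alpha> \<delta> y"
    then obtain z where z: "z \<in> Zminus \<phi> s" "vminus \<alpha> \<delta> z < vminus \<alpha> \<delta> y"
      by blast
    then obtain t x where tx: "\<And>i. 0 \<le> t i" "t sums 1" "\<And>i. x i \<in> S"
        "\<And>n. (\<lambda>i. t i * x i n) sums z n"
      using gen[of z] unfolding countable_convex_combination_def by blast
    have "vminus \<alpha> \<delta> y \<le> vminus \<alpha> \<delta> z"
      by (rule vminus_mixture_ge(1)[OF par tx(1,2) bounds[OF tx(3)] tx(4) y(3)[OF tx(3)]])
    then show False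
      using z by simp
  qed
  assume "\<delta> < 1" and opt: "LP_optimal \<phi> \<alpha> \<delta> s z"
  show "z \<in> S"
  proof (rule ccontr)
    assume "z \<notin> S"
    have z: "z \<in> Zminus \<phi> s" "vminus \<alpha> \<delta> z \<le> vminus \<alpha> \<delta> y"
      using opt y(1) sub by (auto simp: LP_optimal_def is_arg_min_def not_less)
    then obtain t x where tx: "\<And>i. 0 \<le> t i" "t sums 1" "\<And>i. x i \<in> S"
        "\<And>n. (\<lambda>i. t i * x i n) sums z n"
      using gen[of z] unfolding countable_convex_combination_def by blast
    have "t \<noteq> (\<lambda>_. 0)"
      using sums_unique2[OF tx(2), of 0] by auto
    then obtain i where "0 < t i"
      using tx(1) by (auto simp: less_le)
    moreover have "x i \<noteq> z"
      using tx(3) \<open>z \<notin> S\<close> by blast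
    moreover have "vminus \<alpha> \<delta> z < top"
      using z(2) y(2) by (rule le_less_trans)
    ultimately have "vminus \<alpha> \<delta> y < vminus \<alpha> \<delta> z"
      using \<open>\<delta> < 1\<close>
      by (intro vminus_mixture_ge(2)[OF par tx(1,2) bounds[OF tx(3)] tx(4) y(3)[OF tx(3)]])
    then show False
      using z by simp
  qed
qed

section \<open>The jump distribution of a decreasing sequence\<close>

text \<open>Closed form of the partial sum S_k of the overview, which is the moment of the step
  sequence with \<open>k\<close> ones.\<close>

definition geo :: "real \<Rightarrow> nat \<Rightarrow> real" where
  "geo \<phi> k = \<phi> * (1 - \<phi> ^ k) / (1 - \<phi>)"

text \<open>The weight of the step sequence with \<open>k\<close> ones. As entries are indexed from
  0, its last one is at \<open>k - 1\<close>; for \<open>k = 0\<close> the bound 1 replaces the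
  missing entry.\<close>

definition jump :: "(nat \<Rightarrow> real) \<Rightarrow> nat \<Rightarrow> real" where
  "jump z k = (if k = 0 then 1 - z 0 else z (k - 1) - z k)"

text \<open>The factor \<open>of_bool (n < k)\<close> is entry \<open>n\<close> of the step sequence
  with \<open>k\<close> ones; it keeps the jumps from \<open>n + 1\<close> to \<open>N\<close>,
  which telescope.\<close>

lemma jump_partial_sum:
  "n \<le> N \<Longrightarrow> (\<Sum>k<Suc N. jump z k * of_bool (n < k)) = z n - z N"
proof (induction N)
  case (Suc N)
  then show ?case
    by (cases "n = Suc N") (auto simp: jump_def)
qed (simp add: jump_def)

lemma jump_sums:
  assumes "z \<longlonglongrightarrow> 0"
  shows "jump z sums 1" and "(\<lambda>k. jump z k * of_bool (n < k)) sums z n"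
proof -
  have "(\<Sum>k<Suc N. jump z k) = 1 - z N" for N
    by (induction N) (auto simp: jump_def)
  moreover have "(\<lambda>N. 1 - z N) \<longlonglongrightarrow> 1 - 0"
    by (intro tendsto_intros assms)
  ultimately have "(\<lambda>N. \<Sum>k<Suc N. jump z k) \<longlonglongrightarrow> 1"
    by simp
  then show "jump z sums 1"
    unfolding sums_def by (subst (asm) filterlim_sequentially_Suc)
  have "(\<lambda>N. z n - z N) \<longlonglongrightarrow> z n - 0"
    by (intro tendsto_intros assms)
  moreover have "\<forall>\<^sub>F N in sequentially. z n - z N = (\<Sum>k<Suc N. jump z k * of_bool (n < k))"
    using eventually_ge_at_top[of n] by eventually_elim (rule jump_partial_sum[symmetric])
  ultimately have "(\<lambda>N. \<Sum>k<Suc N. jump z k * of_bool (n < k)) \<longlonglongrightarrow> z n - 0"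
    by (rule Lim_transform_eventually)
  then have "(\<lambda>N. \<Sum>k<Suc N. jump z k * of_bool (n < k)) \<longlonglongrightarrow> z n"
    unfolding diff_0_right .
  then show "(\<lambda>k. jump z k * of_bool (n < k)) sums z n"
    unfolding sums_def by (subst (asm) filterlim_sequentially_Suc)
qed

section \<open>Moments of step sequences and feasibility of the generators\<close>

locale loss_part =
  fixes \<phi> s :: real and m :: nat
  assumes phi: "0 < \<phi>" "\<phi> < 1"
    and m: "1 \<le> m"
    and lower: "geo \<phi> (m - 1) \<le> s"
    and upper: "s < geo \<phi> m"
begin

lemma geo_0 [simp]: "geo \<phi> 0 = 0"
  by (simp add: geo_def)

lemma geo_Suc: "geo \<phi> (Suc k) = geo \<phi> k + \<phi> ^ Suc k"
  using phi by (simp add: geo_def field_simps)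

lemma geo_diff: "j \<le> k \<Longrightarrow> geo \<phi> k - geo \<phi> j = \<phi> ^ (j + 1) * (1 - \<phi> ^ (k - j)) / (1 - \<phi>)"
  using phi by (simp add: geo_def right_diff_distrib flip: diff_divide_distrib power_add)

lemma geo_strict_mono: "strict_mono (geo \<phi>)"
  using phi by (intro strict_mono_Suc_iff[THEN iffD2]) (simp add: geo_Suc)

lemma geo_less: "j < k \<Longrightarrow> geo \<phi> j < geo \<phi> k"
  using geo_strict_mono by (simp add: strict_mono_less)

lemma geo_less_sup: "geo \<phi> k < \<phi> / (1 - \<phi>)"
  using phi by (simp add: geo_def divide_simps)

lemma geo_tendsto: "geo \<phi> \<longlonglongrightarrow> \<phi> / (1 - \<phi>)"
proof -
  have "(\<lambda>k. \<phi> * (1 - \<phi> ^ k) / (1 - \<phi>)) \<longlonglongrightarrow> \<phi> * (1 - 0) / (1 - \<phi>)"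
    using phi by (intro tendsto_intros LIMSEQ_realpow_zero) auto
  then show ?thesis
    by (simp add: geo_def[abs_def])
qed

lemma geo_le_s: "j < m \<Longrightarrow> geo \<phi> j \<le> s"
  using order_trans[OF _ lower] strict_mono_less_eq[OF geo_strict_mono, of j "m - 1"] by simp

lemma s_less_geo: "m \<le> k \<Longrightarrow> s < geo \<phi> k"
  using upper strict_mono_less_eq[OF geo_strict_mono, of m k] by simp

text \<open>The probability of \<open>k\<close> under the distribution on \<open>j\<close> and
  \<open>k\<close> for which S has mean \<open>s\<close>.\<close>

definition wt :: "nat \<Rightarrow> nat \<Rightarrow> real" where
  "wt j k = (s - geo \<phi> j) / (geo \<phi> k - geo \<phi> j)"

text \<open>Numerator and denominator of the middle value share a factor \<open>1 - \<phi>\<close>;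
  cancelling it leaves differences of partial sums.\<close>

lemma zjk_eq_wt:
  assumes "j < k"
  shows "zjk \<phi> s j k n = (if n < j then 1 else if n < k then wt j k else 0)"
proof -
  have "(1 - \<phi>) * geo \<phi> j = \<phi> * (1 - \<phi> ^ j)"
    using phi by (simp add: geo_def)
  then have "s * (1 - \<phi>) - \<phi> * (1 - \<phi> ^ j) = (1 - \<phi>) * (s - geo \<phi> j)"
    by (simp add: right_diff_distrib mult.commute)
  moreover have "\<phi> ^ (j + 1) * (1 - \<phi> ^ (k - j)) = (1 - \<phi>) * (geo \<phi> k - geo \<phi> j)"
    using phi assms by (subst geo_diff) auto
  ultimately show ?thesis
    using phi by (simp add: zjk_def wt_def)
qed

lemma zjk_eq_mixture:
  assumes "j < k"
  shows "zjk \<phi> s j k n = (1 - wt j k) * of_bool (n < j) + wt j k * of_bool (n < k)"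
  using assms by (simp add: zjk_eq_wt)

lemma wt_bounds:
  assumes "j < m" "m \<le> k"
  shows "0 \<le> wt j k" "wt j k < 1"
  using assms geo_le_s[of j] s_less_geo[of k] geo_less[of j k] by (auto simp: wt_def)

lemma sum_pow_indicator: "n \<le> N \<Longrightarrow> (\<Sum>i<N. \<phi> ^ Suc i * of_bool (i < n)) = geo \<phi> n"
proof (induction N)
  case (Suc N)
  have *: "(\<Sum>i<n. \<phi> ^ Suc i) = geo \<phi> n" for n
    by (induction n) (auto simp: geo_Suc)
  show ?case
  proof (cases "n = Suc N")
    case True
    then show ?thesis
      using *[of "Suc N"] by simp
  qed (use Suc in auto)
qed simp

text \<open>The moment is the mean of \<open>geo \<phi> j\<close> and \<open>geo \<phi> k\<close>
  with weights \<open>1 - wt j k\<close> and \<open>wt j k\<close>, which is \<open>s\<close> by the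
  choice of \<open>wt\<close>.\<close>

lemma zjk_in_Zminus:
  assumes "j < m" "m \<le> k"
  shows "zjk \<phi> s j k \<in> Zminus \<phi> s"
proof -
  have "j < k"
    using assms by simp
  note w = wt_bounds[OF assms]
  have z: "zjk \<phi> s j k = (\<lambda>n. if n < j then 1 else if n < k then wt j k else 0)"
    using zjk_eq_wt[OF \<open>j < k\<close>] by blast
  have "(\<Sum>n<k. \<phi> ^ Suc n * zjk \<phi> s j k n) = (\<Sum>n<k. (1 - wt j k) * (\<phi> ^ Suc n * of_bool (n < j))
      + wt j k * (\<phi> ^ Suc n * of_bool (n < k)))"
    unfolding zjk_eq_mixture[OF \<open>j < k\<close>] by (intro sum.cong refl) (simp add: algebra_simps)
  also have "\<dots> = (1 - wt j k) * geo \<phi> j + wt j k * geo \<phi> k"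
    unfolding sum.distrib sum_distrib_left[symmetric]
    by (simp only: sum_pow_indicator[OF order_refl] sum_pow_indicator[OF less_imp_le[OF \<open>j < k\<close>]])
  also have "\<dots> = geo \<phi> j + wt j k * (geo \<phi> k - geo \<phi> j)"
    by (simp add: algebra_simps)
  also have "\<dots> = s"
    using geo_less[OF \<open>j < k\<close>] by (simp add: wt_def)
  finally have "(\<lambda>n. \<phi> ^ Suc n * zjk \<phi> s j k n) sums s"
    using sums_finite[of "{..<k}" "\<lambda>n. \<phi> ^ Suc n * zjk \<phi> s j k n"] \<open>j < k\<close> by (simp add: z)
  moreover have "summable (zjk \<phi> s j k)"
    using \<open>j < k\<close> by (intro summable_finite[of "{..<k}"]) (auto simp: z)
  moreover have "decseq (zjk \<phi> s j k)"
    unfolding z decseq_def using w \<open>j < k\<close> by (auto simp: less_imp_le)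
  ultimately show ?thesis
    using w by (auto simp: Zminus_def z)
qed

text \<open>Abel summation.\<close>

lemma jump_mean:
  assumes "z \<in> Zminus \<phi> s"
  shows "(\<lambda>k. jump z k * geo \<phi> k) sums s"
proof -
  have z: "z \<longlonglongrightarrow> 0" "(\<lambda>n. \<phi> ^ Suc n * z n) sums s"
    using assms by (auto simp: Zminus_def summable_LIMSEQ_zero)
  have "(\<Sum>k<Suc N. jump z k * geo \<phi> k) = (\<Sum>n<N. \<phi> ^ Suc n * z n) - geo \<phi> N * z N" for N
    by (induction N) (auto simp: jump_def geo_Suc algebra_simps)
  \<comment> \<open>The boundary term disappears because \<open>geo \<phi>\<close> converges and
    \<open>z\<close> tends to 0.\<close>
  moreover have "(\<lambda>N. (\<Sum>n<N. \<phi> ^ Suc n * z n) - geo \<phi> N * z N) \<longlonglongrightarrow> s - \<phi> / (1 - \<phi>) * 0"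
    using z(2) by (intro tendsto_intros z(1) geo_tendsto) (simp add: sums_def)
  ultimately have "(\<lambda>N. \<Sum>k<Suc N. jump z k * geo \<phi> k) \<longlonglongrightarrow> s"
    by simp
  then show ?thesis
    unfolding sums_def by (subst (asm) filterlim_sequentially_Suc)
qed

section \<open>Decomposition into two-point distributions\<close>

abbreviation generators :: "(nat \<Rightarrow> real) set" where
  "generators \<equiv> \<Union>j \<in> {0..m - 1}. Zj \<phi> s m j"

lemma mem_generators_iff: "x \<in> generators \<longleftrightarrow> (\<exists>j k. j < m \<and> m \<le> k \<and> x = zjk \<phi> s j k)"
proof -
  have "{0..m - 1} = {..<m}"
    using m by auto
  then show ?thesis
    by (auto simp: Zj_def)
qed

text \<open>Used with \<open>g\<close> an indicator of \<open>{n<..}\<close>, for the entries, and with \<open>g = 1\<close>, for the total mass.\<close>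

lemma two_point_mixture:
  fixes p g :: "nat \<Rightarrow> real"
  assumes g: "(\<lambda>k. p k * g k) sums G"
    and mean: "(\<lambda>k. p k * (s - geo \<phi> k)) sums 0"
    and D: "D = (\<Sum>j<m. p j * (s - geo \<phi> j))" "D \<noteq> 0"
  shows "(\<lambda>r. let j = r mod m; k = m + r div m in
      (p j * p k * (geo \<phi> k - geo \<phi> j) / D) * ((1 - wt j k) * g j + wt j k * g k)) sums G"
proof -
  define E where "E = (\<lambda>j k. (p j * p k * (geo \<phi> k - geo \<phi> j) / D)
      * ((1 - wt j k) * g j + wt j k * g k))"
  define Q where "Q = G - (\<Sum>j<m. p j * g j)"
  have q: "(\<lambda>i. p (m + i) * g (m + i)) sums Q"
    unfolding Q_def using sums_split_initial_segment[OF g, of m] by (simp add: add.commute)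
  \<comment> \<open>The deviations from \<open>s\<close> total 0, so the part from \<open>m\<close>
    on balances the part below \<open>m\<close>.\<close>
  have "(\<lambda>i. p (m + i) * (s - geo \<phi> (m + i))) sums (- D)"
    unfolding D using sums_split_initial_segment[OF mean, of m] by (simp add: add.commute)
  from sums_minus[OF this] have d: "(\<lambda>i. p (m + i) * (geo \<phi> (m + i) - s)) sums D"
    by (simp add: algebra_simps)
  have "(\<lambda>i. E j (m + i)) sums (p j * g j + p j * (s - geo \<phi> j) / D * Q)" if "j < m" for j
  proof -
    have "(\<lambda>i. (p j * g j / D) * (p (m + i) * (geo \<phi> (m + i) - s))
        + (p j * (s - geo \<phi> j) / D) * (p (m + i) * g (m + i))) sums
        ((p j * g j / D) * D + (p j * (s - geo \<phi> j) / D) * Q)"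
      by (intro sums_add sums_mult d q)
    moreover have "(p j * g j / D) * (p (m + i) * (geo \<phi> (m + i) - s))
        + (p j * (s - geo \<phi> j) / D) * (p (m + i) * g (m + i)) = E j (m + i)" for i
    proof -
      define k where "k = m + i"
      define b where "b = geo \<phi> k - geo \<phi> j"
      have "0 < b"
        using geo_less[of j k] \<open>j < m\<close> by (simp add: b_def k_def)
      \<comment> \<open>The factor \<open>b\<close> of the pair weight cancels the denominator of
        \<open>wt\<close>, so each term becomes a sum of products of a factor in \<open>j\<close>
        and a factor in \<open>k\<close>.\<close>
      have bw: "b * wt j k = s - geo \<phi> j"
        using \<open>0 < b\<close> unfolding wt_def b_def[symmetric] by simp
      have bw': "b * (1 - wt j k) = geo \<phi> k - s"
        unfolding right_diff_distrib bw by (simp add: b_def)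
      have "E j k = p j / D * p k * (b * (1 - wt j k)) * g j + p j / D * p k * (b * wt j k) * g k"
        unfolding E_def b_def[symmetric] by (simp add: distrib_left mult_ac)
      then show ?thesis
        unfolding k_def[symmetric] bw bw' by (simp add: mult_ac)
    qed
    ultimately show ?thesis
      using D(2) by simp
  qed
  then have "(\<lambda>r. E (r mod m) (m + r div m)) sums
      (\<Sum>j<m. p j * g j + p j * (s - geo \<phi> j) / D * Q)"
    using m by (intro sums_interleave[where f = "\<lambda>j i. E j (m + i)"]) auto
  also have "(\<Sum>j<m. p j * g j + p j * (s - geo \<phi> j) / D * Q) = (\<Sum>j<m. p j * g j) + D / D * Q"
    unfolding sum.distrib sum_distrib_right[symmetric] sum_divide_distrib[symmetric] D(1)[symmetric] ..
  also have "\<dots> = G"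
    using D(2) by (simp add: Q_def)
  finally show ?thesis
    by (simp add: E_def Let_def)
qed

text \<open>The two-point mixture applies to the jumps of \<open>z\<close> once the normalizing
  constant \<open>D\<close> is nonzero. If \<open>D = 0\<close>, no jump has a deviation from the
  mean and \<open>z\<close> is itself a generator.\<close>

lemma countable_convex_combination_generators:
  assumes "z \<in> Zminus \<phi> s"
  shows "countable_convex_combination generators z"
proof -
  define p where "p = jump z"
  have z: "z \<longlonglongrightarrow> 0" "decseq z" "z 0 \<le> 1"
    using assms by (auto simp: Zminus_def summable_LIMSEQ_zero)
  have p: "0 \<le> p k" for k
    using z decseqD[OF z(2), of "k - 1" k] by (auto simp: p_def jump_def)
  note sums = jump_sums[OF z(1), folded p_def]
  have mean: "(\<lambda>k. p k * (s - geo \<phi> k)) sums 0"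
    using sums_diff[OF sums_mult2[OF sums(1), of s] jump_mean[OF assms, folded p_def]]
    by (simp add: algebra_simps)
  define D where "D = (\<Sum>j<m. p j * (s - geo \<phi> j))"
  have a: "0 \<le> p j * (s - geo \<phi> j)" if "j < m" for j
    using p geo_le_s[OF that] by simp
  show ?thesis
  proof (cases "D = 0")
    case False
    then have "0 < D"
      using a sum_nonneg[of "{..<m}" "\<lambda>j. p j * (s - geo \<phi> j)"] by (auto simp: D_def less_le)
    note mix = two_point_mixture[OF _ mean D_def False]
    \<comment> \<open>As \<open>r\<close> varies, \<open>(j, k)\<close> runs through all pairs with
      \<open>j < m\<close> and \<open>m \<le> k\<close>.\<close>
    define t where "t = (\<lambda>r. let j = r mod m; k = m + r div m in p j * p k * (geo \<phi> k - geo \<phi> j) / D)"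
    define x where "x = (\<lambda>r. zjk \<phi> s (r mod m) (m + r div m))"
    have jk: "r mod m < m" "r mod m < m + r div m" "m \<le> m + r div m" for r
      using m by (auto intro: trans_less_add1)
    have "0 \<le> t r" for r
      using p \<open>0 < D\<close> geo_less[OF jk(2)[of r]] by (simp add: t_def Let_def)
    moreover have "t sums 1"
      using mix[of "\<lambda>_. 1" 1] sums(1) by (simp add: t_def[abs_def] Let_def)
    moreover have "x r \<in> generators" for r
      unfolding mem_generators_iff x_def using jk by blast
    moreover have "(\<lambda>r. t r * x r n) sums z n" for n
      using mix[OF sums(2), of n] jk(2) by (simp add: t_def x_def Let_def zjk_eq_mixture)
    ultimately show ?thesis
      unfolding countable_convex_combination_def by blast
  next
    case True
    txt \<open>All the mass sits at \<open>m - 1\<close>.\<close>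
    have "(\<lambda>i. p (m + i) * (geo \<phi> (m + i) - s)) sums 0"
      using sums_minus[OF sums_split_initial_segment[OF mean, of m]] True
      by (simp add: D_def algebra_simps)
    moreover have "0 \<le> p (m + i) * (geo \<phi> (m + i) - s)" for i
      using p s_less_geo[of "m + i"] by simp
    ultimately have "p (m + i) * (geo \<phi> (m + i) - s) = 0" for i
      using suminf_eq_zero_iff[of "\<lambda>i. p (m + i) * (geo \<phi> (m + i) - s)"] by (simp add: sums_iff)
    from this[of "k - m" for k] have high: "p k = 0" if "m \<le> k" for k
      using s_less_geo[OF that] that by (metis eq_iff_diff_eq_0 le_add_diff_inverse less_irrefl mult_eq_0_iff)
    have balance: "p j * (s - geo \<phi> j) = 0" if "j < m" for j
      using a that True sum_nonneg_eq_0_iff[of "{..<m}" "\<lambda>j. p j * (s - geo \<phi> j)"]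
      by (auto simp: D_def)
    \<comment> \<open>Here \<open>geo \<phi> j < geo \<phi> (m - 1) \<le> s\<close>, so the
      deviation is nonzero and the jump must vanish.\<close>
    have low: "p j = 0" if "j < m - 1" for j
      using balance[of j] that geo_less[OF that] lower by auto
    have p_single: "p k = 0" if "k \<noteq> m - 1" for k
      using low high that by (cases "k < m - 1") auto
    then have single: "(\<lambda>k. p k * g k) sums (p (m - 1) * g (m - 1))" for g :: "nat \<Rightarrow> real"
      using sums_finite[of "{m - 1}" "\<lambda>k. p k * g k"] by simp
    have p1: "p (m - 1) = 1"
      using sums_unique2[OF sums(1)] single[of "\<lambda>_. 1"] by simp
    then have s: "s = geo \<phi> (m - 1)"
      using sums_unique2[OF mean single] by simp
    have "z n = of_bool (n < m - 1)" for n
      using sums_unique2[OF sums(2) single] p1 by simp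
    \<comment> \<open>With the mean exactly at \<open>geo \<phi> (m - 1)\<close>, the middle block
      of the generator is zero and only its \<open>m - 1\<close> ones remain.\<close>
    moreover have "wt (m - 1) m = 0"
      unfolding wt_def using s by simp
    then have "zjk \<phi> s (m - 1) m n = of_bool (n < m - 1)" for n
      using m zjk_eq_mixture[of "m - 1" m n] by simp
    ultimately have "z = zjk \<phi> s (m - 1) m"
      by (intro ext) simp
    then have "z \<in> generators"
      unfolding mem_generators_iff using m by (intro exI[of _ "m - 1"] exI[of _ m]) auto
    \<comment> \<open>The mixture representing a single point: all weight is put on index 0.\<close>
    moreover have "(\<lambda>i. of_bool (i = (0::nat)) * z n) sums z n" for n
      using sums_finite[of "{0}" "\<lambda>i. of_bool (i = 0) * z n"] by simp
    moreover have "(\<lambda>i. of_bool (i = 0)) sums (1::real)"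
      using sums_single[of 0 "\<lambda>_. 1::real"] by (simp add: of_bool_def)
    ultimately show ?thesis
      unfolding countable_convex_combination_def
      by (intro exI[of _ "\<lambda>i. of_bool (i = 0)"] exI[of _ "\<lambda>_. z"] conjI allI) (assumption | simp)+
  qed
qed

section \<open>Values of the objective on the generators and their minimum\<close>

lemma vminus_zjk:
  assumes "j < m" "m \<le> k" "0 \<le> \<alpha>"
  shows "vminus \<alpha> \<delta> (zjk \<phi> s j k) = ennreal (\<Sum>n<k.
    (real (n + 2) powr \<alpha> - real (n + 1) powr \<alpha>) * zjk \<phi> s j k n powr \<delta>)"
proof -
  have "vminus \<alpha> \<delta> (zjk \<phi> s j k) = (\<Sum>n<k. ennreal
      ((real (n + 2) powr \<alpha> - real (n + 1) powr \<alpha>) * zjk \<phi> s j k n powr \<delta>))"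
    unfolding vminus_def using assms by (intro suminf_finite) (auto simp: zjk_eq_wt)
  also have "\<dots> = ennreal (\<Sum>n<k.
      (real (n + 2) powr \<alpha> - real (n + 1) powr \<alpha>) * zjk \<phi> s j k n powr \<delta>)"
    using assms by (intro sum_ennreal mult_nonneg_nonneg) (auto intro: powr_mono2)
  finally show ?thesis .
qed

text \<open>Since \<open>geo \<phi> k - geo \<phi> j\<close> never exceeds
  \<open>\<phi> / (1 - \<phi>)\<close>, the middle value \<open>wt j k\<close> has a lower bound
  independent of \<open>k\<close>. The objective's weights over positions \<open>m\<close> to
  \<open>k - 1\<close> telescope.\<close>

lemma vminus_zjk_ge:
  assumes "j < m" "m \<le> k" "0 < \<alpha>" "0 < \<delta>"
  shows "ennreal (((s - geo \<phi> j) / (\<phi> / (1 - \<phi>))) powr \<delta>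
    * (real (k + 1) powr \<alpha> - real (m + 1) powr \<alpha>)) \<le> vminus \<alpha> \<delta> (zjk \<phi> s j k)"
proof -
  define c where "c = (\<lambda>n. real (n + 2) powr \<alpha> - real (n + 1) powr \<alpha>)"
  define w where "w = ((s - geo \<phi> j) / (\<phi> / (1 - \<phi>))) powr \<delta>"
  have c: "0 \<le> c n" for n
    using vminus_weight_pos[OF \<open>0 < \<alpha>\<close>, of n] by (simp add: c_def)
  have "j < k"
    using assms by simp
  have "geo \<phi> k - geo \<phi> j \<le> \<phi> / (1 - \<phi>)"
    using geo_less_sup[of k] geo_less[of 0 j] by (cases "j = 0") auto
  then have "(s - geo \<phi> j) / (\<phi> / (1 - \<phi>)) \<le> wt j k"
    unfolding wt_def using geo_le_s[OF assms(1)] geo_less[OF \<open>j < k\<close>]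
    by (intro divide_left_mono mult_pos_pos) (use phi in auto)
  then have w: "w \<le> wt j k powr \<delta>"
    unfolding w_def using geo_le_s[OF assms(1)] phi assms(4) by (intro powr_mono2) auto
  have "real (k + 1) powr \<alpha> - real (m + 1) powr \<alpha> = (\<Sum>n=m..<k. c n)"
    using sum_Suc_diff'[OF assms(2), of "\<lambda>n. real (n + 1) powr \<alpha>"] by (simp add: c_def add_ac)
  then have "w * (real (k + 1) powr \<alpha> - real (m + 1) powr \<alpha>) = (\<Sum>n=m..<k. c n * w)"
    by (simp add: sum_distrib_left mult.commute)
  also have "\<dots> \<le> (\<Sum>n=m..<k. c n * zjk \<phi> s j k n powr \<delta>)"
    using assms(1) \<open>j < k\<close> w c by (intro sum_mono mult_left_mono) (auto simp: zjk_eq_wt)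
  also have "\<dots> \<le> (\<Sum>n<k. c n * zjk \<phi> s j k n powr \<delta>)"
    using c by (intro sum_mono2) auto
  finally show ?thesis
    using assms by (simp add: vminus_zjk w_def c_def ennreal_leI)
qed

lemma vminus_zjk_eventually_ge:
  assumes "j < m" "0 < \<alpha>" "0 < \<delta>"
  shows "\<forall>\<^sub>F k in sequentially. vminus \<alpha> \<delta> (zjk \<phi> s j m) \<le> vminus \<alpha> \<delta> (zjk \<phi> s j k)"
proof (cases "s = geo \<phi> j")
  case True
  then have "wt j k = 0" for k
    unfolding wt_def by simp
  then have *: "zjk \<phi> s j k = zjk \<phi> s j m" if "k \<ge> m" for k
    using assms that by (intro ext) (simp add: zjk_eq_wt)
  show ?thesis
    using eventually_ge_at_top[of m]
  proof eventually_elim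
    case (elim k)
    show ?case
      unfolding *[OF elim] by simp
  qed
next
  case False
  define w where "w = ((s - geo \<phi> j) / (\<phi> / (1 - \<phi>))) powr \<delta>"
  have "0 < w"
    using False geo_le_s[OF assms(1)] phi by (simp add: w_def)
  obtain B where B: "vminus \<alpha> \<delta> (zjk \<phi> s j m) = ennreal B"
    using vminus_zjk[OF assms(1) order_refl less_imp_le[OF assms(2)]] by (rule that)
  \<comment> \<open>The factor \<open>w\<close> is positive and independent of \<open>k\<close>, so
    the lower bound grows like \<open>k\<close> to the power \<open>\<alpha>\<close> and passes the
    fixed value \<open>B\<close>.\<close>
  have "filterlim (\<lambda>k. w * (real (k + 1) powr \<alpha> - real (m + 1) powr \<alpha>)) at_top sequentially"
    using \<open>0 < w\<close> \<open>0 < \<alpha>\<close> by real_asymp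
  then have "\<forall>\<^sub>F k in sequentially. B \<le> w * (real (k + 1) powr \<alpha> - real (m + 1) powr \<alpha>)"
    by (simp add: filterlim_at_top)
  then show ?thesis
    using eventually_ge_at_top[of m]
  proof eventually_elim
    case (elim k)
    then have "ennreal B \<le> ennreal (w * (real (k + 1) powr \<alpha> - real (m + 1) powr \<alpha>))"
      by (intro ennreal_leI)
    also have "\<dots> \<le> vminus \<alpha> \<delta> (zjk \<phi> s j k)"
      unfolding w_def by (rule vminus_zjk_ge) (use assms elim in auto)
    finally show ?case
      by (simp add: B)
  qed
qed

text \<open>The finitely many \<open>j\<close> have a common threshold \<open>K\<close> beyond which
  \<open>k = m\<close> is at least as good, so a minimum over a finite grid is global.\<close>

lemma ex_minimal_generator:
  assumes "0 < \<alpha>" "0 < \<delta>"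
  shows "\<exists>y \<in> generators. \<forall>x \<in> generators. vminus \<alpha> \<delta> y \<le> vminus \<alpha> \<delta> x"
proof -
  define v where "v = (\<lambda>j k. vminus \<alpha> \<delta> (zjk \<phi> s j k))"
  have "\<forall>\<^sub>F k in sequentially. \<forall>j\<in>{..<m}. v j m \<le> v j k"
    unfolding v_def using vminus_zjk_eventually_ge[OF _ assms] by (intro eventually_ball_finite) auto
  then obtain K where K: "\<And>k j. K \<le> k \<Longrightarrow> j < m \<Longrightarrow> v j m \<le> v j k"
    by (auto simp: eventually_sequentially)
  \<comment> \<open>The grid contains the comparison point \<open>m\<close> for every
    \<open>j\<close>, and every \<open>k\<close> past its end exceeds \<open>K\<close>.\<close>
  define P where "P = {..<m} \<times> {m..m + K}"
  have P: "finite P" "P \<noteq> {}"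
    using m by (auto simp: P_def lessThan_empty_iff)
  obtain q where q: "q \<in> P" "\<And>r. r \<in> P \<Longrightarrow> case_prod v q \<le> case_prod v r"
    using arg_min_if_finite[OF P, of "case_prod v"] by (meson not_le)
  obtain j0 k0 where jk: "q = (j0, k0)"
    by (cases q)
  have "v j0 k0 \<le> v j k" if "j < m" "m \<le> k" for j k
  proof (cases "k \<le> m + K")
    case True
    then show ?thesis
      using q(2)[of "(j, k)"] that by (simp add: jk P_def)
  next
    case False
    have "v j0 k0 \<le> v j m"
      using q(2)[of "(j, m)"] that by (simp add: jk P_def)
    also have "\<dots> \<le> v j k"
      using False that by (intro K) auto
    finally show ?thesis .
  qed
  then have "\<forall>x \<in> generators. v j0 k0 \<le> vminus \<alpha> \<delta> x"
    unfolding Ball_def mem_generators_iff by (auto simp: v_def)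
  moreover have "zjk \<phi> s j0 k0 \<in> generators"
    unfolding mem_generators_iff using q(1) by (auto simp: jk P_def)
  ultimately show ?thesis
    unfolding v_def by blast
qed

lemma generators_subset_Zminus: "generators \<subseteq> Zminus \<phi> s"
  unfolding subset_iff mem_generators_iff using zjk_in_Zminus by blast

lemma vminus_generator_finite:
  assumes "x \<in> generators" "0 \<le> \<alpha>"
  shows "vminus \<alpha> \<delta> x < top"
  using assms unfolding mem_generators_iff by (auto simp: vminus_zjk)

end

text \<open>For \<open>\<delta> = 1\<close> the objective is linear, so mixtures of tied minimal
  generators are optimal too. Hence an optimal generator is asserted for all
  \<open>\<delta>\<close>, and membership of every optimal solution for
  \<open>\<delta> < 1\<close>.\<close>

theorem proposition5p4:
  fixes \<phi> \<alpha> \<delta> s :: real and m :: nat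
  assumes "0 < \<phi>" and "\<phi> < 1"
    and "0 < \<alpha>" and "\<alpha> < 1"
    and "0 < \<delta>" and "\<delta> \<le> 1"
    and "1 \<le> m"
    and "\<phi> * (1 - \<phi> ^ (m - 1)) / (1 - \<phi>) \<le> s"
    and "s < \<phi> * (1 - \<phi> ^ m) / (1 - \<phi>)"
  shows "(\<forall>z \<in> Zminus \<phi> s. countable_convex_combination (\<Union>j \<in> {0..m - 1}. Zj \<phi> s m j) z) \<and>
         (\<exists>z \<in> (\<Union>j \<in> {0..m - 1}. Zj \<phi> s m j). LP_optimal \<phi> \<alpha> \<delta> s z) \<and>
         (\<delta> < 1 \<longrightarrow> (\<forall>z. LP_optimal \<phi> \<alpha> \<delta> s z \<longrightarrow> z \<in> (\<Union>j \<in> {0..m - 1}. Zj \<phi> s m j)))"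
proof -
  interpret loss_part \<phi> s m
    using assms by unfold_locales (auto simp: geo_def)
  obtain y where y: "y \<in> generators" "\<And>x. x \<in> generators \<Longrightarrow> vminus \<alpha> \<delta> y \<le> vminus \<alpha> \<delta> x"
    using ex_minimal_generator[OF assms(3,5)] by blast
  have "vminus \<alpha> \<delta> y < top"
    using vminus_generator_finite[OF y(1)] assms by simp
  note opt = LP_optimal_of_convex_generators[OF assms(3,5,6) generators_subset_Zminus
      countable_convex_combination_generators y(1) this y(2)]
  show ?thesis
    using countable_convex_combination_generators opt y(1) by blast
qed

end
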